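(* Let $P=(P_{il})_{1\le i\le m,\,1\le l\le N}$ satisfy $P_{il}\ge0$ and $\sum_{i=1}^m P_{il}=1$ for all $l$. For $i\in\{1,\dots,m\}$ let $\boldsymbol{P}_i=(P_{i1},\dots,P_{iN})^\top$, and let $\Phi$ be the $n\times N$ matrix with entries $\phi_{jl}=\Pr(Z\in B_l\mid X=x_j)-\Pr(Z\in B_l)$. Then the randomized estimator $\hat Y_P(Z)$ satisfies the perfect privacy condition (that is, $\hat Y_P(Z)$ is independent of $X$) if and only if $\boldsymbol{P}_i\in\mathrm{Null}(\Phi)$ for all $i\in\{1,\dots,m\}$, where $\mathrm{Null}(\Phi)$ is the null space of $\Phi$.
   Context: $X$ (private) and $Y$ (public) are possibly correlated discrete random variables with finite support sets $\mathcal{X}=\{x_1,\dots,x_n\}$ and $\mathcal{Y}=\{y_1,\dots,y_m\}$ (so $\Pr(X=x_j)>0$ for all $j$). The measurement $Z$ is a real random variable, jointly distributed with $(X,Y)$, absolutely continuous with respect to Lebesgue measure. $\{B_l\}_{l=1}^N$ is a partition of $\mathbb{R}$ into intervals (up to endpoints, which have probability zero), with $B_1,B_N$ semi-infinite and $B_2,\dots,B_{N-1}$ bounded. Randomized estimator from discretized measurements: $\hat Y_P(Z)$ is the $\mathcal{Y}$-valued random variable that equals $y_i$ with probability $P_{il}$ when $Z\in B_l$, the randomization being conditionally independent of $(X,Y)$ given $Z$. An estimator satisfies the perfect privacy condition if its output is independent of the private random variable $X$. *)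

theory Defs
  imports "HOL-Probability.Probability" "Jordan_Normal_Form.Matrix_Kernel"
begin

text \<open>
  All index ranges are shifted to start at 0, following \<^const>\<open>Matrix.mat\<close>: the bins are
  \<open>B 0, \<dots>, B (N - 1)\<close>, the private values \<open>x 0, \<dots>, x (n - 1)\<close> and the public values
  \<open>y 0, \<dots>, y (m - 1)\<close>.
\<close>

definition has_finite_support :: "'a measure \<Rightarrow> ('a \<Rightarrow> 'b) \<Rightarrow> 'b set \<Rightarrow> bool" where
  "has_finite_support M X S \<longleftrightarrow>
     finite S \<and> X \<in> M \<rightarrow>\<^sub>M count_space S \<and> (\<forall>s\<in>S. \<P>(\<omega> in M. X \<omega> = s) > 0)"

definition semi_infinite_interval :: "real set \<Rightarrow> bool" where
  "semi_infinite_interval I \<longleftrightarrow> is_interval I \<and> bdd_above I \<noteq> bdd_below I"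

text \<open>
  The endpoints of an interval are its frontier points. Two bins may share only common
  endpoints, and only endpoints of bins may be left uncovered.
\<close>

definition interval_partition :: "nat \<Rightarrow> (nat \<Rightarrow> real set) \<Rightarrow> bool" where
  "interval_partition N B \<longleftrightarrow>
     2 \<le> N \<and>
     semi_infinite_interval (B 0) \<and>
     semi_infinite_interval (B (N - 1)) \<and>
     (\<forall>l. 0 < l \<and> l < N - 1 \<longrightarrow> is_interval (B l) \<and> B l \<noteq> {} \<and> bounded (B l)) \<and>
     (\<forall>l<N. \<forall>k<N. l \<noteq> k \<longrightarrow> B l \<inter> B k \<subseteq> frontier (B l) \<inter> frontier (B k)) \<and>
     UNIV - (\<Union>l<N. B l) \<subseteq> (\<Union>l<N. frontier (B l))"

definition prob_given :: "'a measure \<Rightarrow> ('a \<Rightarrow> real) \<Rightarrow> ('a \<Rightarrow> bool) \<Rightarrow> 'a \<Rightarrow> real" where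
  "prob_given M Z Q =
     real_cond_exp M (vimage_algebra (space M) Z borel) (indicator {\<omega> \<in> space M. Q \<omega>})"

definition cond_indep_given ::
  "'a measure \<Rightarrow> ('a \<Rightarrow> real) \<Rightarrow> 'b measure \<Rightarrow> ('a \<Rightarrow> 'b) \<Rightarrow> 'c measure \<Rightarrow> ('a \<Rightarrow> 'c) \<Rightarrow> bool" where
  "cond_indep_given M Z S V T W \<longleftrightarrow>
     V \<in> M \<rightarrow>\<^sub>M S \<and> W \<in> M \<rightarrow>\<^sub>M T \<and>
     (\<forall>A\<in>sets S. \<forall>C\<in>sets T. AE \<omega> in M.
        prob_given M Z (\<lambda>\<omega>. V \<omega> \<in> A \<and> W \<omega> \<in> C) \<omega> =
        prob_given M Z (\<lambda>\<omega>. V \<omega> \<in> A) \<omega> * prob_given M Z (\<lambda>\<omega>. W \<omega> \<in> C) \<omega>)"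

definition column_stochastic :: "nat \<Rightarrow> nat \<Rightarrow> real mat \<Rightarrow> bool" where
  "column_stochastic m N P \<longleftrightarrow>
     P \<in> carrier_mat m N \<and>
     (\<forall>i<m. \<forall>l<N. 0 \<le> P $$ (i, l)) \<and>
     (\<forall>l<N. (\<Sum>i<m. P $$ (i, l)) = 1)"

text \<open>
  \<open>Yhat\<close> is any random variable on the common probability space with the prescribed
  conditional law given \<open>Z\<close> and whose randomization is conditionally independent of the
  pair \<open>(X, Y)\<close> given \<open>Z\<close>.
\<close>

definition randomized_estimator ::
  "'a measure \<Rightarrow> 'x set \<Rightarrow> ('a \<Rightarrow> 'x) \<Rightarrow> nat \<Rightarrow> (nat \<Rightarrow> 'y) \<Rightarrow> ('a \<Rightarrow> 'y) \<Rightarrow> ('a \<Rightarrow> real) \<Rightarrow>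
   nat \<Rightarrow> (nat \<Rightarrow> real set) \<Rightarrow> real mat \<Rightarrow> ('a \<Rightarrow> 'y) \<Rightarrow> bool" where
  "randomized_estimator M SX X m y Y Z N B P Yhat \<longleftrightarrow>
     Yhat \<in> M \<rightarrow>\<^sub>M count_space (y ` {..<m}) \<and>
     (\<forall>i<m. \<forall>l<N. AE \<omega> in M. Z \<omega> \<in> B l \<longrightarrow>
        prob_given M Z (\<lambda>\<omega>. Yhat \<omega> = y i) \<omega> = P $$ (i, l)) \<and>
     cond_indep_given M Z (count_space (y ` {..<m})) Yhat
       (count_space (SX \<times> y ` {..<m})) (\<lambda>\<omega>. (X \<omega>, Y \<omega>))"

text \<open>
  The library's \<open>indep_var\<close> forces both random variables to have the same codomain type, so
  independence is stated for the generated sigma algebras.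
\<close>

definition perfect_privacy ::
  "'a measure \<Rightarrow> 'x set \<Rightarrow> ('a \<Rightarrow> 'x) \<Rightarrow> 'y set \<Rightarrow> ('a \<Rightarrow> 'y) \<Rightarrow> bool" where
  "perfect_privacy M SX X SY Yhat \<longleftrightarrow>
     Yhat \<in> M \<rightarrow>\<^sub>M count_space SY \<and> X \<in> M \<rightarrow>\<^sub>M count_space SX \<and>
     prob_space.indep_set M
       (sets (vimage_algebra (space M) Yhat (count_space SY)))
       (sets (vimage_algebra (space M) X (count_space SX)))"

definition Phi ::
  "'a measure \<Rightarrow> nat \<Rightarrow> (nat \<Rightarrow> 'x) \<Rightarrow> ('a \<Rightarrow> 'x) \<Rightarrow> ('a \<Rightarrow> real) \<Rightarrow> nat \<Rightarrow> (nat \<Rightarrow> real set) \<Rightarrow> real mat" where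
  "Phi M n x X Z N B = Matrix.mat n N (\<lambda>(j, l).
     \<P>(\<omega> in M. Z \<omega> \<in> B l \<bar> X \<omega> = x j) - \<P>(\<omega> in M. Z \<omega> \<in> B l))"

end

theory Submission
  imports Defs
begin

text \<open>
  Integrating the conditional probabilities over \<open>{Z \<in> B\<^sub>l}\<close>, where \<open>Pr(Yhat = y\<^sub>i | Z)\<close> is the
  constant \<open>P\<^sub>i\<^sub>l\<close>, conditional independence gives
  \<open>Pr(Yhat = y\<^sub>i, X = x\<^sub>j) = \<Sum>\<^sub>l P\<^sub>i\<^sub>l Pr(Z \<in> B\<^sub>l, X = x\<^sub>j)\<close> and likewise
  \<open>Pr(Yhat = y\<^sub>i) = \<Sum>\<^sub>l P\<^sub>i\<^sub>l Pr(Z \<in> B\<^sub>l)\<close>. Hence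
  \<open>Pr(Yhat = y\<^sub>i, X = x\<^sub>j) - Pr(Yhat = y\<^sub>i) Pr(X = x\<^sub>j) = Pr(X = x\<^sub>j) (\<Phi> P\<^sub>i)\<^sub>j\<close>.
\<close>

section \<open>Independence of finitely valued random variables\<close>

text \<open>The extra event \<open>E\<close> lets one decomposition serve both joint probabilities
  and, with \<open>E = space M\<close>, marginals.\<close>

lemma (in prob_space) prob_eq_sum_count_space:
  assumes "finite S" "U \<in> M \<rightarrow>\<^sub>M count_space S" "A \<subseteq> S" "E \<in> events"
  shows "prob {\<omega> \<in> space M. U \<omega> \<in> A \<and> \<omega> \<in> E} = (\<Sum>s\<in>A. prob {\<omega> \<in> space M. U \<omega> = s \<and> \<omega> \<in> E})"
proof -
  have m: "{\<omega> \<in> space M. U \<omega> = s \<and> \<omega> \<in> E} \<in> events" if "s \<in> A" for s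
  proof -
    have "U -` {s} \<inter> space M \<in> events"
      using assms(2,3) that by (intro measurable_sets[of U M "count_space S"]) auto
    then have "(U -` {s} \<inter> space M) \<inter> E \<in> events" using assms(4) by blast
    also have "(U -` {s} \<inter> space M) \<inter> E = {\<omega> \<in> space M. U \<omega> = s \<and> \<omega> \<in> E}" by auto
    finally show ?thesis .
  qed
  have "{\<omega> \<in> space M. U \<omega> \<in> A \<and> \<omega> \<in> E} = (\<Union>s\<in>A. {\<omega> \<in> space M. U \<omega> = s \<and> \<omega> \<in> E})" by auto
  moreover have "prob \<dots> = (\<Sum>s\<in>A. prob {\<omega> \<in> space M. U \<omega> = s \<and> \<omega> \<in> E})"
    using m assms(1,3) by (intro finite_measure_finite_Union)
      (auto simp: disjoint_family_on_def intro: finite_subset)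
  ultimately show ?thesis by simp
qed

text \<open>Each generated sigma algebra consists of preimages of subsets of a finite set, hence of
  finite disjoint unions of fibres. The product rule on pairs of fibres therefore extends to all
  pairs of events by additivity in one variable and then in the other.\<close>

lemma (in prob_space) indep_set_vimage_count_space_iff:
  assumes S: "finite S" and U: "U \<in> M \<rightarrow>\<^sub>M count_space S"
    and T: "finite T" and V: "V \<in> M \<rightarrow>\<^sub>M count_space T"
  shows "indep_set (sets (vimage_algebra (space M) U (count_space S)))
           (sets (vimage_algebra (space M) V (count_space T))) \<longleftrightarrow>
         (\<forall>s\<in>S. \<forall>t\<in>T. \<P>(\<omega> in M. U \<omega> = s \<and> V \<omega> = t) = \<P>(\<omega> in M. U \<omega> = s) * \<P>(\<omega> in M. V \<omega> = t))"
    (is "?L \<longleftrightarrow> ?R")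
proof
  have US: "U \<in> space M \<rightarrow> S" and VT: "V \<in> space M \<rightarrow> T"
    using measurable_space[OF U] measurable_space[OF V] by auto
  note sets = sets_vimage_algebra2[of U "space M" "count_space S"]
    sets_vimage_algebra2[of V "space M" "count_space T"]
  show ?R if ?L
  proof (intro ballI)
    fix s t assume st: "s \<in> S" "t \<in> T"
    have "prob ((U -` {s} \<inter> space M) \<inter> (V -` {t} \<inter> space M))
        = prob (U -` {s} \<inter> space M) * prob (V -` {t} \<inter> space M)"
      using st US VT by (intro indep_setD[OF that]) (auto simp: sets)
    also have "(U -` {s} \<inter> space M) \<inter> (V -` {t} \<inter> space M) = {\<omega> \<in> space M. U \<omega> = s \<and> V \<omega> = t}"
      by auto
    also have "U -` {s} \<inter> space M = {\<omega> \<in> space M. U \<omega> = s}" by auto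
    also have "V -` {t} \<inter> space M = {\<omega> \<in> space M. V \<omega> = t}" by auto
    finally show "\<P>(\<omega> in M. U \<omega> = s \<and> V \<omega> = t) = \<P>(\<omega> in M. U \<omega> = s) * \<P>(\<omega> in M. V \<omega> = t)" .
  qed
  show ?L if R: ?R
    unfolding indep_sets2_eq
  proof (intro conjI ballI)
    show "sets (vimage_algebra (space M) U (count_space S)) \<subseteq> events"
      using US measurable_sets[OF U] by (auto simp: sets)
    show "sets (vimage_algebra (space M) V (count_space T)) \<subseteq> events"
      using VT measurable_sets[OF V] by (auto simp: sets)
    fix a c assume "a \<in> sets (vimage_algebra (space M) U (count_space S))"
      "c \<in> sets (vimage_algebra (space M) V (count_space T))"
    then obtain A C where A: "A \<subseteq> S" "a = {\<omega> \<in> space M. U \<omega> \<in> A}"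
      and C: "C \<subseteq> T" "c = {\<omega> \<in> space M. V \<omega> \<in> C}"
      using US VT by (auto simp: sets)
    have cE: "c \<in> events"
      using measurable_sets[OF V, of C] C by (auto simp: vimage_def Int_def conj_commute)
    \<comment> \<open>The first of the two summations: the fibre over \<open>s\<close> stays fixed
      while \<open>c\<close> is split into fibres of \<open>V\<close>. Splitting \<open>a\<close>
      comes afterwards, with \<open>c\<close> as the extra event.\<close>
    have pc: "\<P>(\<omega> in M. U \<omega> = s \<and> \<omega> \<in> c) = \<P>(\<omega> in M. U \<omega> = s) * prob c" if "s \<in> S" for s
    proof -
      have "{\<omega> \<in> space M. U \<omega> = s} \<in> events"
        using measurable_sets[OF U, of "{s}"] that by (auto simp: vimage_def Int_def conj_commute)
      from prob_eq_sum_count_space[OF T V C(1) this]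
      have "\<P>(\<omega> in M. U \<omega> = s \<and> \<omega> \<in> c) = (\<Sum>t\<in>C. \<P>(\<omega> in M. U \<omega> = s \<and> V \<omega> = t))"
        unfolding C(2) by (simp add: conj_commute cong: conj_cong)
      also have "\<dots> = (\<Sum>t\<in>C. \<P>(\<omega> in M. U \<omega> = s) * \<P>(\<omega> in M. V \<omega> = t))"
        using R that C by (intro sum.cong) auto
      also have "\<dots> = \<P>(\<omega> in M. U \<omega> = s) * prob c"
        using prob_eq_sum_count_space[OF T V C(1) sets.top] C(2)
        by (simp add: sum_distrib_left cong: conj_cong)
      finally show ?thesis .
    qed
    have "prob (a \<inter> c) = \<P>(\<omega> in M. U \<omega> \<in> A \<and> \<omega> \<in> c)"
      unfolding A(2) by (auto intro!: arg_cong[where f = prob])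
    also have "\<dots> = (\<Sum>s\<in>A. \<P>(\<omega> in M. U \<omega> = s) * prob c)"
      unfolding prob_eq_sum_count_space[OF S U A(1) cE] using pc A by (intro sum.cong) auto
    also have "\<dots> = prob a * prob c"
      using prob_eq_sum_count_space[OF S U A(1) sets.top] A(2)
      by (simp add: sum_distrib_right cong: conj_cong)
    finally show "prob (a \<inter> c) = prob a * prob c" .
  qed
qed

section \<open>Conditional probabilities integrated over a bin\<close>

text \<open>The event that \<open>Z\<close> lies in \<open>D\<close> belongs to the sigma algebra
  generated by \<open>Z\<close>, so this is the defining property of conditional expectation applied
  to an indicator. Integrability is recorded because it later supplies measurability of the
  integrands.\<close>

lemma (in prob_space) set_integral_prob_given:
  assumes Z: "Z \<in> borel_measurable M" and D: "D \<in> sets borel"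
    and Q: "{\<omega> \<in> space M. Q \<omega>} \<in> events"
  shows "(LINT \<omega>:{\<omega> \<in> space M. Z \<omega> \<in> D}|M. prob_given M Z Q \<omega>) = \<P>(\<omega> in M. Q \<omega> \<and> Z \<omega> \<in> D)"
    and "set_integrable M {\<omega> \<in> space M. Z \<omega> \<in> D} (prob_given M Z Q)"
proof -
  let ?F = "vimage_algebra (space M) Z borel" and ?G = "{\<omega> \<in> space M. Z \<omega> \<in> D}"
  have "subalgebra M ?F"
    using Z by (auto simp: subalgebra_def sets_vimage_algebra2 intro: measurable_sets)
  then interpret finite_measure_subalgebra M ?F by unfold_locales
  have G: "?G \<in> sets ?F"
    using D by (auto simp: sets_vimage_algebra2 vimage_def Int_def conj_commute)
  have GM: "?G \<in> events" using G subalg by (auto simp: subalgebra_def)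
  have i: "integrable M (indicat_real {\<omega> \<in> space M. Q \<omega>})"
    using Q by (auto simp: emeasure_eq_measure)
  show "set_integrable M ?G (prob_given M Z Q)"
    unfolding prob_given_def set_integrable_def
    using GM real_cond_exp_int(1)[OF i] by (rule integrable_mult_indicator)
  have "(LINT \<omega>:?G|M. prob_given M Z Q \<omega>) = (LINT \<omega>:?G|M. indicat_real {\<omega> \<in> space M. Q \<omega>} \<omega>)"
    unfolding prob_given_def by (rule real_cond_exp_intA[OF i G, symmetric])
  also have "\<dots> = (LINT \<omega>|M. indicat_real {\<omega> \<in> space M. Q \<omega> \<and> Z \<omega> \<in> D} \<omega>)"
    unfolding set_lebesgue_integral_def
    by (intro Bochner_Integration.integral_cong) (auto simp: indicator_def)
  also have "\<dots> = \<P>(\<omega> in M. Q \<omega> \<and> Z \<omega> \<in> D)"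
    by (auto intro!: arg_cong[where f = prob])
  finally show "(LINT \<omega>:?G|M. prob_given M Z Q \<omega>) = \<P>(\<omega> in M. Q \<omega> \<and> Z \<omega> \<in> D)" .
qed

text \<open>Under the integral over the bin, conditional independence factors the integrand; one
  factor is almost surely the constant \<open>p\<close> there and comes out, and the other
  integrates back to a probability.\<close>

lemma (in prob_space) prob_conj_eq_mult_on_bin:
  assumes Z: "Z \<in> borel_measurable M" and D: "D \<in> sets borel"
    and Q: "{\<omega> \<in> space M. Q \<omega>} \<in> events" and R: "{\<omega> \<in> space M. R \<omega>} \<in> events"
    and ci: "AE \<omega> in M. prob_given M Z (\<lambda>\<omega>. Q \<omega> \<and> R \<omega>) \<omega> = prob_given M Z Q \<omega> * prob_given M Z R \<omega>"
    and p: "AE \<omega> in M. Z \<omega> \<in> D \<longrightarrow> prob_given M Z Q \<omega> = p"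
  shows "\<P>(\<omega> in M. (Q \<omega> \<and> R \<omega>) \<and> Z \<omega> \<in> D) = p * \<P>(\<omega> in M. R \<omega> \<and> Z \<omega> \<in> D)"
proof -
  let ?G = "{\<omega> \<in> space M. Z \<omega> \<in> D}"
  have "{\<omega> \<in> space M. Q \<omega>} \<inter> {\<omega> \<in> space M. R \<omega>} \<in> events" using Q R by blast
  also have "{\<omega> \<in> space M. Q \<omega>} \<inter> {\<omega> \<in> space M. R \<omega>} = {\<omega> \<in> space M. Q \<omega> \<and> R \<omega>}" by auto
  finally have QR: "{\<omega> \<in> space M. Q \<omega> \<and> R \<omega>} \<in> events" .
  have G: "?G \<in> events" using Z D by measurable
  have meas: "set_borel_measurable M ?G (prob_given M Z S)"
    if "{\<omega> \<in> space M. S \<omega>} \<in> events" for S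
    using set_integral_prob_given(2)[OF Z D that]
    by (auto simp: set_borel_measurable_def set_integrable_def)
  have "\<P>(\<omega> in M. (Q \<omega> \<and> R \<omega>) \<and> Z \<omega> \<in> D) = (LINT \<omega>:?G|M. prob_given M Z (\<lambda>\<omega>. Q \<omega> \<and> R \<omega>) \<omega>)"
    using set_integral_prob_given(1)[OF Z D QR] by simp
  also have "\<dots> = (LINT \<omega>:?G|M. p * prob_given M Z R \<omega>)"
    unfolding set_lebesgue_integral_def
  proof (rule integral_cong_AE)
    show "(\<lambda>\<omega>. indicat_real ?G \<omega> *\<^sub>R prob_given M Z (\<lambda>\<omega>. Q \<omega> \<and> R \<omega>) \<omega>) \<in> borel_measurable M"
      using meas[OF QR] by (simp add: set_borel_measurable_def)
    \<comment> \<open>The constant is first kept outside the indicator, where \<open>meas\<close>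
      applies directly.\<close>
    have "(\<lambda>\<omega>. p * (indicat_real ?G \<omega> *\<^sub>R prob_given M Z R \<omega>)) \<in> borel_measurable M"
      using meas[OF R] unfolding set_borel_measurable_def by measurable
    then show "(\<lambda>\<omega>. indicat_real ?G \<omega> *\<^sub>R (p * prob_given M Z R \<omega>)) \<in> borel_measurable M"
      by (simp add: mult.left_commute)
    show "AE \<omega> in M. indicat_real ?G \<omega> *\<^sub>R prob_given M Z (\<lambda>\<omega>. Q \<omega> \<and> R \<omega>) \<omega> =
        indicat_real ?G \<omega> *\<^sub>R (p * prob_given M Z R \<omega>)"
      using ci p by eventually_elim (auto simp: indicator_def)
  qed
  also have "\<dots> = p * (LINT \<omega>:?G|M. prob_given M Z R \<omega>)" by simp
  also have "\<dots> = p * \<P>(\<omega> in M. R \<omega> \<and> Z \<omega> \<in> D)"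
    using set_integral_prob_given(1)[OF Z D R] by simp
  finally show ?thesis .
qed

section \<open>The bins as an almost sure partition\<close>

lemma interval_partition_is_interval:
  assumes "interval_partition N B" "l < N"
  shows "is_interval (B l)"
proof -
  have "l = 0 \<or> l = N - 1 \<or> 0 < l \<and> l < N - 1" using assms(2) by linarith
  then show ?thesis
    using assms(1) unfolding interval_partition_def semi_infinite_interval_def by (elim disjE) auto
qed

text \<open>Frontiers of intervals are Lebesgue null, so by absolute continuity \<open>Z\<close>
  almost surely avoids all of them; away from them the bins cover the line and are disjoint. A sum
  of indicators equal to 1 expresses covering and disjointness at once.\<close>

lemma interval_partition_AE:
  assumes B: "interval_partition N B" and Z: "Z \<in> borel_measurable M"
    and ac: "absolutely_continuous lborel (distr M borel Z)"
  shows "AE \<omega> in M. (\<Sum>l<N. indicat_real (B l) (Z \<omega>)) = 1"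
proof -
  have null: "AE \<omega> in M. Z \<omega> \<notin> frontier (B l)" if "l < N" for l
  proof -
    have "negligible (frontier (B l))"
      using interval_partition_is_interval[OF B that]
      by (intro negligible_convex_frontier) (simp add: is_interval_convex)
    \<comment> \<open>Negligible sets are null for the completed measure; a frontier is closed,
      hence Borel, and so null for \<open>lborel\<close> itself.\<close>
    then have "frontier (B l) \<in> null_sets lborel"
      by (metis frontier_closed borel_closed negligible_iff_null_sets null_sets_completion_iff
          sets_lborel)
    then have "frontier (B l) \<in> null_sets (distr M borel Z)"
      using ac by (auto simp: absolutely_continuous_def)
    then have "AE z in distr M borel Z. z \<notin> frontier (B l)" by (rule AE_not_in)
    then show ?thesis using Z by (rule AE_distrD[rotated])
  qed
  then have "AE \<omega> in M. \<forall>l\<in>{..<N}. Z \<omega> \<notin> frontier (B l)"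
    by (intro AE_finite_allI) auto
  then show ?thesis
  proof eventually_elim
    case (elim \<omega>)
    then have "Z \<omega> \<in> (\<Union>l<N. B l)" using B unfolding interval_partition_def by blast
    then obtain k where k: "k < N" "Z \<omega> \<in> B k" by auto
    \<comment> \<open>A point in two distinct bins would lie on the frontier of both.\<close>
    have other: "Z \<omega> \<notin> B l" if "l < N" "l \<noteq> k" for l
      using B elim k that unfolding interval_partition_def by blast
    have "(\<Sum>l<N. indicat_real (B l) (Z \<omega>)) = (\<Sum>l<N. if l = k then 1 else 0)"
      using k other by (intro sum.cong) auto
    then show ?case using k by simp
  qed
qed

text \<open>Bins may share endpoints or miss some, so additivity over sets does not apply directly.
  Instead the almost sure identity for the indicators of the bins is multiplied by the indicator of
  \<open>Q\<close> and integrated.\<close>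

lemma (in prob_space) prob_eq_sum_bins:
  assumes B: "interval_partition N B" and Z: "Z \<in> borel_measurable M"
    and ac: "absolutely_continuous lborel (distr M borel Z)"
    and Q: "{\<omega> \<in> space M. Q \<omega>} \<in> events"
  shows "\<P>(\<omega> in M. Q \<omega>) = (\<Sum>l<N. \<P>(\<omega> in M. Q \<omega> \<and> Z \<omega> \<in> B l))"
proof -
  have ev: "{\<omega> \<in> space M. Q \<omega> \<and> Z \<omega> \<in> B l} \<in> events" if "l < N" for l
  proof -
    have "{\<omega> \<in> space M. Z \<omega> \<in> B l} \<in> events"
      using Z real_interval_borel_measurable[OF interval_partition_is_interval[OF B that]] by measurable
    then have "{\<omega> \<in> space M. Q \<omega>} \<inter> {\<omega> \<in> space M. Z \<omega> \<in> B l} \<in> events" using Q by blast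
    also have "{\<omega> \<in> space M. Q \<omega>} \<inter> {\<omega> \<in> space M. Z \<omega> \<in> B l} = {\<omega> \<in> space M. Q \<omega> \<and> Z \<omega> \<in> B l}"
      by auto
    finally show ?thesis .
  qed
  have "\<P>(\<omega> in M. Q \<omega>) = (LINT \<omega>|M. indicat_real {\<omega> \<in> space M. Q \<omega>} \<omega>)"
    using Q by (simp add: Int_absorb2 sets.sets_into_space)
  also have "\<dots> = (LINT \<omega>|M. (\<Sum>l<N. indicat_real {\<omega> \<in> space M. Q \<omega> \<and> Z \<omega> \<in> B l} \<omega>))"
  proof (rule integral_cong_AE)
    show "indicat_real {\<omega> \<in> space M. Q \<omega>} \<in> borel_measurable M" using Q by simp
    show "(\<lambda>\<omega>. \<Sum>l<N. indicat_real {\<omega> \<in> space M. Q \<omega> \<and> Z \<omega> \<in> B l} \<omega>) \<in> borel_measurable M"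
      using ev by (intro borel_measurable_sum) simp
    show "AE \<omega> in M. indicat_real {\<omega> \<in> space M. Q \<omega>} \<omega> =
        (\<Sum>l<N. indicat_real {\<omega> \<in> space M. Q \<omega> \<and> Z \<omega> \<in> B l} \<omega>)"
      using interval_partition_AE[OF B Z ac] AE_space
    proof eventually_elim
      case (elim \<omega>)
      have "(\<Sum>l<N. indicat_real {\<omega> \<in> space M. Q \<omega> \<and> Z \<omega> \<in> B l} \<omega>) =
          (\<Sum>l<N. indicat_real {\<omega> \<in> space M. Q \<omega>} \<omega> * indicat_real (B l) (Z \<omega>))"
        using elim by (intro sum.cong) (auto simp: indicator_def)
      then show ?case using elim by (simp flip: sum_distrib_left)
    qed
  qed
  also have "\<dots> = (\<Sum>l<N. LINT \<omega>|M. indicat_real {\<omega> \<in> space M. Q \<omega> \<and> Z \<omega> \<in> B l} \<omega>)"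
    using ev by (intro Bochner_Integration.integral_sum) (auto simp: emeasure_eq_measure)
  also have "\<dots> = (\<Sum>l<N. \<P>(\<omega> in M. Q \<omega> \<and> Z \<omega> \<in> B l))"
    using ev by (intro sum.cong) (auto intro!: arg_cong[where f = prob])
  finally show ?thesis .
qed

section \<open>Joint law of the estimator and the private variable\<close>

text \<open>The event is split over the bins and the product formula is applied on each. A general
  set \<open>C\<close> covers two uses: a singleton gives the joint law, and all of
  \<open>SX\<close> gives the marginal law of \<open>Yhat\<close>.\<close>

lemma (in prob_space) randomized_estimator_joint_prob:
  assumes re: "randomized_estimator M SX X m y Y Z N B P Yhat"
    and X: "X \<in> M \<rightarrow>\<^sub>M count_space SX" and Y: "Y \<in> M \<rightarrow>\<^sub>M count_space (y ` {..<m})"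
    and B: "interval_partition N B" and Z: "Z \<in> borel_measurable M"
    and ac: "absolutely_continuous lborel (distr M borel Z)"
    and i: "i < m" and C: "C \<subseteq> SX"
  shows "\<P>(\<omega> in M. Yhat \<omega> = y i \<and> X \<omega> \<in> C) =
    (\<Sum>l<N. P $$ (i, l) * \<P>(\<omega> in M. X \<omega> \<in> C \<and> Z \<omega> \<in> B l))"
proof -
  have Yh: "Yhat \<in> M \<rightarrow>\<^sub>M count_space (y ` {..<m})" using re by (simp add: randomized_estimator_def)
  have q: "{\<omega> \<in> space M. Yhat \<omega> = y i} \<in> events"
    using measurable_sets[OF Yh, of "{y i}"] i by (auto simp: vimage_def Int_def conj_commute)
  have r: "{\<omega> \<in> space M. X \<omega> \<in> C} \<in> events"
    using measurable_sets[OF X, of C] C by (auto simp: vimage_def Int_def conj_commute)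
  have ev: "{\<omega> \<in> space M. Yhat \<omega> = y i \<and> X \<omega> \<in> C} \<in> events"
  proof -
    have "{\<omega> \<in> space M. Yhat \<omega> = y i} \<inter> {\<omega> \<in> space M. X \<omega> \<in> C} \<in> events" using q r by blast
    also have "{\<omega> \<in> space M. Yhat \<omega> = y i} \<inter> {\<omega> \<in> space M. X \<omega> \<in> C} =
      {\<omega> \<in> space M. Yhat \<omega> = y i \<and> X \<omega> \<in> C}" by auto
    finally show ?thesis .
  qed
  \<comment> \<open>A conditional probability depends on a predicate only through its values on
    \<open>space M\<close>; this permits dropping conditions that always hold there.\<close>
  have cong: "prob_given M Z Q = prob_given M Z Q'" if "\<And>\<omega>. \<omega> \<in> space M \<Longrightarrow> Q \<omega> = Q' \<omega>" for Q Q'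
  proof -
    have "{\<omega> \<in> space M. Q \<omega>} = {\<omega> \<in> space M. Q' \<omega>}" using that by auto
    then show ?thesis by (simp only: prob_given_def)
  qed
  have YS: "Y \<omega> \<in> y ` {..<m}" if "\<omega> \<in> space M" for \<omega> using measurable_space[OF Y that] by simp
  \<comment> \<open>Conditional independence is assumed for the pair of \<open>X\<close> and
    \<open>Y\<close>. Testing it on \<open>C\<close> times the full range of \<open>Y\<close> leaves
    a condition on \<open>X\<close> alone.\<close>
  have "AE \<omega> in M. prob_given M Z (\<lambda>\<omega>. Yhat \<omega> \<in> {y i} \<and> (X \<omega>, Y \<omega>) \<in> C \<times> y ` {..<m}) \<omega> =
      prob_given M Z (\<lambda>\<omega>. Yhat \<omega> \<in> {y i}) \<omega> * prob_given M Z (\<lambda>\<omega>. (X \<omega>, Y \<omega>) \<in> C \<times> y ` {..<m}) \<omega>"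
    using re i C unfolding randomized_estimator_def cond_indep_given_def
    by (elim conjE) (drule bspec[of _ _ "{y i}"], simp, erule bspec, auto)
  also have "prob_given M Z (\<lambda>\<omega>. Yhat \<omega> \<in> {y i} \<and> (X \<omega>, Y \<omega>) \<in> C \<times> y ` {..<m}) =
      prob_given M Z (\<lambda>\<omega>. Yhat \<omega> = y i \<and> X \<omega> \<in> C)"
    using YS by (intro cong) auto
  also have "prob_given M Z (\<lambda>\<omega>. (X \<omega>, Y \<omega>) \<in> C \<times> y ` {..<m}) = prob_given M Z (\<lambda>\<omega>. X \<omega> \<in> C)"
    using YS by (intro cong) auto
  also have "prob_given M Z (\<lambda>\<omega>. Yhat \<omega> \<in> {y i}) = prob_given M Z (\<lambda>\<omega>. Yhat \<omega> = y i)"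
    by simp
  finally have ci: "AE \<omega> in M. prob_given M Z (\<lambda>\<omega>. Yhat \<omega> = y i \<and> X \<omega> \<in> C) \<omega> =
      prob_given M Z (\<lambda>\<omega>. Yhat \<omega> = y i) \<omega> * prob_given M Z (\<lambda>\<omega>. X \<omega> \<in> C) \<omega>" .
  have "\<P>(\<omega> in M. (Yhat \<omega> = y i \<and> X \<omega> \<in> C) \<and> Z \<omega> \<in> B l) =
      P $$ (i, l) * \<P>(\<omega> in M. X \<omega> \<in> C \<and> Z \<omega> \<in> B l)" if "l < N" for l
    using re i that
    by (intro prob_conj_eq_mult_on_bin Z q r ci
        real_interval_borel_measurable[OF interval_partition_is_interval[OF B that]])
      (simp add: randomized_estimator_def)
  then show ?thesis
    unfolding prob_eq_sum_bins[OF B Z ac ev] by (intro sum.cong) auto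
qed

theorem lemma4:
  fixes M :: "'a measure"
    and X :: "'a \<Rightarrow> 'x" and Y Yhat :: "'a \<Rightarrow> 'y" and Z :: "'a \<Rightarrow> real"
    and x :: "nat \<Rightarrow> 'x" and y :: "nat \<Rightarrow> 'y" and n m N :: nat
    and B :: "nat \<Rightarrow> real set" and P :: "real mat"
  assumes "prob_space M"
    and "inj_on x {..<n}" and "has_finite_support M X (x ` {..<n})"
    and "inj_on y {..<m}" and "has_finite_support M Y (y ` {..<m})"
    and "Z \<in> borel_measurable M" and "absolutely_continuous lborel (distr M borel Z)"
    and "interval_partition N B"
    and "column_stochastic m N P"
    and "randomized_estimator M (x ` {..<n}) X m y Y Z N B P Yhat"
  shows "perfect_privacy M (x ` {..<n}) X (y ` {..<m}) Yhat \<longleftrightarrow>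
    (\<forall>i<m. Matrix.row P i \<in> mat_kernel (Phi M n x X Z N B))"
proof -
  interpret prob_space M by fact
  have pos: "\<P>(\<omega> in M. X \<omega> = x j) > 0" if "j < n" for j
    using assms(3) that by (auto simp: has_finite_support_def)
  have X: "X \<in> M \<rightarrow>\<^sub>M count_space (x ` {..<n})" and Y: "Y \<in> M \<rightarrow>\<^sub>M count_space (y ` {..<m})"
    using assms(3,5) by (auto simp: has_finite_support_def)
  have Yh: "Yhat \<in> M \<rightarrow>\<^sub>M count_space (y ` {..<m})"
    using assms(10) by (simp add: randomized_estimator_def)
  have P: "P \<in> carrier_mat m N" using assms(9) by (simp add: column_stochastic_def)
  note joint = randomized_estimator_joint_prob[OF assms(10) X Y assms(8,6,7)]
  have XS: "X \<omega> \<in> x ` {..<n}" if "\<omega> \<in> space M" for \<omega> using measurable_space[OF X that] by simp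
  \<comment> \<open>With \<open>C\<close> the full range of \<open>X\<close>, the condition on
    \<open>X\<close> is vacuous on \<open>space M\<close>.\<close>
  have marg: "\<P>(\<omega> in M. Yhat \<omega> = y i) = (\<Sum>l<N. P $$ (i, l) * \<P>(\<omega> in M. Z \<omega> \<in> B l))"
    if "i < m" for i
    using joint[OF that order_refl] XS by (simp cong: conj_cong)
  \<comment> \<open>The factor \<P>(X = x j) clears the denominator of the conditional probabilities
    in \<open>Phi\<close>. It is positive by \<open>pos\<close>, so the entry vanishes exactly when
    the right-hand side does.\<close>
  have row: "(Phi M n x X Z N B *\<^sub>v Matrix.row P i) $ j * \<P>(\<omega> in M. X \<omega> = x j) =
      \<P>(\<omega> in M. Yhat \<omega> = y i \<and> X \<omega> = x j) - \<P>(\<omega> in M. Yhat \<omega> = y i) * \<P>(\<omega> in M. X \<omega> = x j)"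
    if i: "i < m" and j: "j < n" for i j
  proof -
    have "(Phi M n x X Z N B *\<^sub>v Matrix.row P i) $ j =
        (\<Sum>l<N. (\<P>(\<omega> in M. Z \<omega> \<in> B l \<bar> X \<omega> = x j) - \<P>(\<omega> in M. Z \<omega> \<in> B l)) * P $$ (i, l))"
      using i j P by (simp add: Phi_def scalar_prod_def lessThan_atLeast0)
    also have "\<dots> * \<P>(\<omega> in M. X \<omega> = x j) =
        (\<Sum>l<N. P $$ (i, l) * \<P>(\<omega> in M. X \<omega> = x j \<and> Z \<omega> \<in> B l)
          - P $$ (i, l) * \<P>(\<omega> in M. Z \<omega> \<in> B l) * \<P>(\<omega> in M. X \<omega> = x j))"
      using pos[OF j] unfolding sum_distrib_right
      by (intro sum.cong) (auto simp: cond_prob_def field_simps conj_commute)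
    also have "\<dots> = \<P>(\<omega> in M. Yhat \<omega> = y i \<and> X \<omega> = x j) - \<P>(\<omega> in M. Yhat \<omega> = y i) * \<P>(\<omega> in M. X \<omega> = x j)"
      using joint[OF i, of "{x j}"] j marg[OF i] by (simp add: sum_subtractf sum_distrib_right)
    finally show ?thesis .
  qed
  \<comment> \<open>The kernel also prescribes the length \<open>N\<close> of its vectors, which the
    shape of \<open>P\<close> guarantees; the equation with the zero vector is then read entry by
    entry.\<close>
  have "Matrix.row P i \<in> mat_kernel (Phi M n x X Z N B) \<longleftrightarrow>
      (\<forall>j<n. (Phi M n x X Z N B *\<^sub>v Matrix.row P i) $ j = 0)" if "i < m" for i
    using P that by (auto simp: mat_kernel_def Phi_def vec_eq_iff)
  also have "(\<forall>j<n. (Phi M n x X Z N B *\<^sub>v Matrix.row P i) $ j = 0) \<longleftrightarrow>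
      (\<forall>j<n. \<P>(\<omega> in M. Yhat \<omega> = y i \<and> X \<omega> = x j) = \<P>(\<omega> in M. Yhat \<omega> = y i) * \<P>(\<omega> in M. X \<omega> = x j))"
    if "i < m" for i
  proof (intro all_cong)
    fix j assume "j < n"
    then show "(Phi M n x X Z N B *\<^sub>v Matrix.row P i) $ j = 0 \<longleftrightarrow>
        \<P>(\<omega> in M. Yhat \<omega> = y i \<and> X \<omega> = x j) = \<P>(\<omega> in M. Yhat \<omega> = y i) * \<P>(\<omega> in M. X \<omega> = x j)"
      using row[OF that, of j] pos[of j] by auto
  qed
  finally have "(\<forall>i<m. Matrix.row P i \<in> mat_kernel (Phi M n x X Z N B)) \<longleftrightarrow>
      (\<forall>i<m. \<forall>j<n. \<P>(\<omega> in M. Yhat \<omega> = y i \<and> X \<omega> = x j) = \<P>(\<omega> in M. Yhat \<omega> = y i) * \<P>(\<omega> in M. X \<omega> = x j))"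
    by blast
  \<comment> \<open>Both supports are images of initial segments of the naturals, so the product
    rule over values turns into one over indices.\<close>
  then show ?thesis
    using indep_set_vimage_count_space_iff[OF _ Yh _ X] Yh X
    by (simp add: perfect_privacy_def) (simp only: Ball_def lessThan_iff)
qed

end
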